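(* Let $r>0$, $t_0\in\mathbb{R}$, and let $L(t)$, $t\geqslant t_0$, be a family of bounded linear functionals on $\mathcal{C}=\mathcal{C}([-r,0],\mathbb{C})$, represented as $$L(t)\varphi=\int_0^r d_\theta\eta(t,\theta)\,\varphi(-\theta),\qquad \varphi\in\mathcal{C},$$ where for each $t\geqslant t_0$ the function $\eta(t,\cdot):[0,r]\to\mathbb{C}$ is of bounded variation, $\eta(t,0)=0$, and $\eta(t,\cdot)$ is continuous from the right in $(0,r)$. Assume that $\lambda:[t_0-r,\infty)\to\mathbb{C}$ is a continuous function satisfying the generalized characteristic equation $$\lambda(t)=\int_0^r d_\theta\eta(t,\theta)\,\exp\Big(-\int_{t-\theta}^t\lambda(s)\,ds\Big),\qquad t\geqslant t_0,$$ and such that $$\limsup_{t\to\infty}\int_0^r\theta\,\Big|e^{-\int_{t-\theta}^t\lambda(s)\,ds}\Big|\,d_\theta|\eta|(t,\theta)<1.$$ Then for each solution $x$ of the linear nonautonomous retarded functional differential equation $$x'(t)=L(t)x_t,\qquad t\geqslant t_0,$$ the limit $$\lim_{t\to\infty}x(t)\,e^{-\int_{t_0}^t\lambda(s)\,ds}$$ exists (in $\mathbb{C}$), and $$\lim_{t\to\infty}\Big[x(t)\,e^{-\int_{t_0}^t\lambda(s)\,ds}\Big]'=0.$$ Furthermore, if the limit $\lim_{t\to\infty}\lambda(t)\,x(t)\,e^{-\int_{t_0}^t\lambda(s)\,ds}$ exists, then $$\lim_{t\to\infty}x'(t)\,e^{-\int_{t_0}^t\lambda(s)\,ds}=\lim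_{t\to\infty}\lambda(t)\,x(t)\,e^{-\int_{t_0}^t\lambda(s)\,ds}.$$
   Context: $\mathcal{C}([-r,0],\mathbb{C})$ is the Banach space of continuous functions $[-r,0]\to\mathbb{C}$ with the supremum norm. For a function $x$ on $[t_0-r,\infty)$ and $t\geqslant t_0$, the segment $x_t\in\mathcal{C}$ is $x_t(\theta)=x(t+\theta)$, $\theta\in[-r,0]$; thus $L(t)x_t=\int_0^r d_\theta\eta(t,\theta)\,x(t-\theta)$. Integrals $\int_0^r d_\theta\eta(t,\theta)\,f(\theta)$ are Riemann–Stieltjes integrals over $[0,r]$ with respect to $\theta\mapsto\eta(t,\theta)$, for fixed $t$. For each $t$, $|\eta|(t,\theta)$ denotes the total variation of $\eta(t,\cdot)$ on $[0,\theta]$, and $d_\theta|\eta|(t,\theta)$ denotes Stieltjes integration with respect to this nondecreasing function of $\theta$. A solution of $x'(t)=L(t)x_t$, $t\geqslant t_0$, is a continuous function $x:[t_0-r,\infty)\to\mathbb{C}$ that is continuously differentiable on $[t_0,\infty)$ (the derivative at $t_0$ being the derivative from the right) and satisfies the equation for every $t\geqslant t_0$. The prime denotes differentiation with respect to $t$. *)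

theory Defs
  imports "HOL-Analysis.Analysis"
begin

text \<open>
  Degenerate intervals \<open>{c..c}\<close> may occur in a (tagged) division; they contribute \<open>0\<close> to the
  sums below. For a nonempty closed interval \<open>k\<close>, \<open>Inf k\<close> and \<open>Sup k\<close> are its end points.
\<close>

definition has_rs_integral ::
  "('a::real_normed_field) \<Rightarrow> (real \<Rightarrow> 'a) \<Rightarrow> (real \<Rightarrow> 'a) \<Rightarrow> real \<Rightarrow> real \<Rightarrow> bool" where
  "has_rs_integral I f g a b \<longleftrightarrow>
     (\<forall>\<epsilon>>0. \<exists>\<delta>>0. \<forall>p. p tagged_division_of {a..b} \<and> (\<forall>(\<xi>, k)\<in>p. Sup k - Inf k < \<delta>) \<longrightarrow>
        norm ((\<Sum>(\<xi>, k)\<in>p. f \<xi> * (g (Sup k) - g (Inf k))) - I) < \<epsilon>)"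

text \<open>
  The Riemann--Stieltjes integral of \<open>f\<close> with respect to \<open>g\<close> over \<open>[a,b]\<close>, as the limit of the
  Riemann--Stieltjes sums as the mesh tends to \<open>0\<close>. The whole closed interval is
  meant: jumps of \<open>g\<close> at \<open>a\<close> and at \<open>b\<close> count.
\<close>

definition rs_integral :: "(real \<Rightarrow> 'a) \<Rightarrow> (real \<Rightarrow> 'a) \<Rightarrow> real \<Rightarrow> real \<Rightarrow> 'a::real_normed_field" where
  "rs_integral f g a b = (THE I. has_rs_integral I f g a b)"

definition bounded_variation_on :: "(real \<Rightarrow> 'a::real_normed_vector) \<Rightarrow> real \<Rightarrow> real \<Rightarrow> bool" where
  "bounded_variation_on g a b \<longleftrightarrow>
     (\<exists>B. \<forall>D. D division_of {a..b} \<longrightarrow> (\<Sum>k\<in>D. norm (g (Sup k) - g (Inf k))) \<le> B)"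

text \<open>A real supremum, hence meaningful only for functions of bounded variation.\<close>

definition total_variation :: "(real \<Rightarrow> 'a::real_normed_vector) \<Rightarrow> real \<Rightarrow> real \<Rightarrow> real" where
  "total_variation g a b =
     (SUP D\<in>{D. D division_of {a..b}}. \<Sum>k\<in>D. norm (g (Sup k) - g (Inf k)))"

text \<open>
  Elements of \<open>C([-r,0], complex)\<close> are represented by total functions that are continuous on
  \<open>[-r,0]\<close>. Linearity together with the bound in terms of the supremum norm forces a functional
  to depend only on the restriction of its argument to \<open>[-r,0]\<close>.
\<close>

definition bounded_linear_functional_C :: "real \<Rightarrow> ((real \<Rightarrow> complex) \<Rightarrow> complex) \<Rightarrow> bool" where
  "bounded_linear_functional_C r F \<longleftrightarrow>
     (\<forall>\<phi> \<psi>. continuous_on {-r..0} \<phi> \<and> continuous_on {-r..0} \<psi> \<longrightarrow>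
        F (\<lambda>\<theta>. \<phi> \<theta> + \<psi> \<theta>) = F \<phi> + F \<psi>) \<and>
     (\<forall>c \<phi>. continuous_on {-r..0} \<phi> \<longrightarrow> F (\<lambda>\<theta>. c * \<phi> \<theta>) = c * F \<phi>) \<and>
     (\<exists>K. \<forall>\<phi>. continuous_on {-r..0} \<phi> \<longrightarrow> norm (F \<phi>) \<le> K * (SUP \<theta>\<in>{-r..0}. norm (\<phi> \<theta>)))"

definition segment_at :: "(real \<Rightarrow> complex) \<Rightarrow> real \<Rightarrow> real \<Rightarrow> complex" where
  "segment_at x t = (\<lambda>\<theta>. x (t + \<theta>))"

text \<open>Derivatives within \<open>[t\<^sub>0,\<infinity>)\<close> are right derivatives at \<open>t\<^sub>0\<close> and two-sided ones elsewhere.\<close>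

definition rfde_solution ::
  "real \<Rightarrow> real \<Rightarrow> (real \<Rightarrow> (real \<Rightarrow> complex) \<Rightarrow> complex) \<Rightarrow> (real \<Rightarrow> complex) \<Rightarrow> bool" where
  "rfde_solution r t\<^sub>0 L x \<longleftrightarrow>
     continuous_on {t\<^sub>0 - r..} x \<and>
     (\<exists>x'. continuous_on {t\<^sub>0..} x' \<and>
       (\<forall>t\<ge>t\<^sub>0. (x has_vector_derivative x' t) (at t within {t\<^sub>0..}) \<and>
                x' t = L t (segment_at x t)))"

end

theory Submission
  imports Defs "HOL-Real_Asymp.Real_Asymp"
begin

text \<open>
  Write \<open>y(t) = x(t) exp(-\<integral>\<^sub>t\<^sub>0\<^sup>t \<lambda>)\<close>. Subtracting \<open>x(t)\<close> times the characteristic equation from the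
  differential equation cancels everything but differences of values of \<open>y\<close>: for \<open>t \<ge> t\<^sub>0 + r\<close>

    \<open>y'(t) = \<integral>\<^sub>0\<^sup>r d\<^sub>\<theta>\<eta>(t,\<theta>) exp(-\<integral>\<^sub>t\<^sub>-\<^sub>\<theta>\<^sup>t \<lambda>) (y(t-\<theta>) - y(t))\<close>.

  By the mean value inequality \<open>|y(t-\<theta>) - y(t)|\<close> is at most \<open>\<theta>\<close> times the maximum of \<open>|y'|\<close> over
  \<open>[t-r,t]\<close>. So \<open>|y'(t)|\<close> is at most the integral in the limit superior condition times that maximum
  (\<open>norm_y'_le\<close>); from some time on the factor is at most a constant \<open>q < 1\<close>. A function bounded by
  \<open>q\<close> times its own maximum over the preceding delay interval decays exponentially
  (\<open>delay_inequality_exponential_decay\<close>). Hence \<open>y'\<close> tends to \<open>0\<close> and is integrable near infinity, so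
  \<open>y\<close> converges. The last claim follows from \<open>x' exp(-\<integral>\<lambda>) = \<lambda> x exp(-\<integral>\<lambda>) + y'\<close>.

  The estimate of the Stieltjes integral needs some Riemann--Stieltjes theory: a continuous function
  is integrable with respect to any \<open>g\<close> whose increments are dominated by those of a function \<open>V\<close>, and
  the integral is bounded by an integral with respect to \<open>V\<close>. It is applied twice, to \<open>g = \<eta>(t,\<cdot>)\<close>
  with \<open>V\<close> its total variation, and to \<open>g = V\<close>, so that monotone integrators need no separate
  treatment.
\<close>

section \<open>Riemann--Stieltjes sums and common refinements\<close>

definition rs_sum :: "(real \<Rightarrow> 'a::real_normed_field) \<Rightarrow> (real \<Rightarrow> 'a) \<Rightarrow> (real \<times> real set) set \<Rightarrow> 'a" where
  "rs_sum f g p = (\<Sum>(\<xi>, k)\<in>p. f \<xi> * (g (Sup k) - g (Inf k)))"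

definition mesh_less :: "real \<Rightarrow> (real \<times> real set) set \<Rightarrow> bool" where
  "mesh_less \<delta> p \<longleftrightarrow> (\<forall>(\<xi>, k)\<in>p. Sup k - Inf k < \<delta>)"

text \<open>
  The increment of \<open>g\<close> over the interval \<open>k \<inter> l\<close>. Only end points enter, so that the intersection
  itself, which may be empty, never has to be formed; disjoint intervals contribute \<open>0\<close>.
\<close>
definition overlap_increment :: "(real \<Rightarrow> 'a::real_normed_vector) \<Rightarrow> real set \<Rightarrow> real set \<Rightarrow> 'a" where
  "overlap_increment g k l =
     (let u = max (Inf k) (Inf l); v = min (Sup k) (Sup l) in if u \<le> v then g v - g u else 0)"

text \<open>
  This stands in for bounded variation of \<open>g\<close>: the total variation is one possible \<open>V\<close>, and every such
  \<open>V\<close> dominates its own increments, since they are nonnegative.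
\<close>
definition increments_dominated_on ::
    "(real \<Rightarrow> 'a::real_normed_vector) \<Rightarrow> (real \<Rightarrow> real) \<Rightarrow> real \<Rightarrow> real \<Rightarrow> bool" where
  "increments_dominated_on g V a b \<longleftrightarrow>
     (\<forall>u v. a \<le> u \<longrightarrow> u \<le> v \<longrightarrow> v \<le> b \<longrightarrow> norm (g v - g u) \<le> V v - V u)"

lemma has_rs_integral_iff:
  "has_rs_integral I f g a b \<longleftrightarrow>
     (\<forall>\<epsilon>>0. \<exists>\<delta>>0. \<forall>p. p tagged_division_of {a..b} \<and> mesh_less \<delta> p \<longrightarrow> norm (rs_sum f g p - I) < \<epsilon>)"
  by (simp add: has_rs_integral_def rs_sum_def mesh_less_def)

lemma has_rs_integralE:
  assumes "has_rs_integral I f g a b" "\<epsilon> > 0"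
  obtains \<delta> where "\<delta> > 0"
    "\<And>p. p tagged_division_of {a..b} \<Longrightarrow> mesh_less \<delta> p \<Longrightarrow> norm (rs_sum f g p - I) < \<epsilon>"
  using assms unfolding has_rs_integral_iff by metis

lemma overlap_increment_commute: "overlap_increment g k l = overlap_increment g l k"
  by (simp add: overlap_increment_def max.commute min.commute)

lemma tagged_division_of_intervalE:
  fixes a b :: real
  assumes "p tagged_division_of {a..b}" "(\<xi>, k) \<in> p"
  obtains u v where "k = {u..v}" "u \<le> v" "a \<le> u" "v \<le> b" "\<xi> \<in> {u..v}"
proof -
  obtain u v where k: "k = cbox u v"
    using tagged_division_ofD(4)[OF assms] by blast
  have "\<xi> \<in> k" "k \<subseteq> {a..b}"
    using tagged_division_ofD(2,3)[OF assms] by auto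
  with k show thesis
    by (intro that[of u v]) auto
qed

text \<open>
  The increment of \<open>g\<close> over the overlap of \<open>{u..v}\<close> and \<open>l\<close> is the increment over \<open>l\<close> of \<open>g\<close> composed
  with the projection of the line onto \<open>{u..v}\<close>, and the increments of that one function telescope
  along a division. This replaces the construction of a common refinement of two divisions.
\<close>
lemma sum_overlap_increment:
  fixes g :: "real \<Rightarrow> 'a::real_normed_vector"
  assumes p: "p tagged_division_of {a..b}" and "a \<le> u" "u \<le> v" "v \<le> b"
  shows "(\<Sum>(\<zeta>, l)\<in>p. overlap_increment g {u..v} l) = g v - g u"
proof -
  let ?G = "\<lambda>s. g (max u (min v s))"
  have "(\<Sum>(\<zeta>, l)\<in>p. overlap_increment g {u..v} l) = (\<Sum>(\<zeta>, l)\<in>p. ?G (Sup l) - ?G (Inf l))"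
  proof (rule sum.cong[OF refl], clarify)
    fix \<zeta> l assume "(\<zeta>, l) \<in> p"
    then obtain w z where "l = {w..z}" "w \<le> z"
      using p by (elim tagged_division_of_intervalE)
    with \<open>u \<le> v\<close> show "overlap_increment g {u..v} l = ?G (Sup l) - ?G (Inf l)"
      by (auto simp: overlap_increment_def Let_def max_def min_def)
  qed
  also have "\<dots> = ?G b - ?G a"
    using assms by (intro additive_tagged_division_1) auto
  also have "\<dots> = g v - g u"
    using assms by (simp add: max_absorb1 max_absorb2 min_absorb1 min_absorb2)
  finally show ?thesis .
qed

lemma increment_eq_sum_overlap:
  fixes g :: "real \<Rightarrow> 'a::real_normed_vector"
  assumes "p tagged_division_of {a..b}" "p' tagged_division_of {a..b}" "(\<xi>, k) \<in> p"
  shows "g (Sup k) - g (Inf k) = (\<Sum>(\<zeta>, l)\<in>p'. overlap_increment g k l)"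
proof -
  obtain u v where "k = {u..v}" "u \<le> v" "a \<le> u" "v \<le> b"
    using tagged_division_of_intervalE[OF assms(1,3)] by metis
  then show ?thesis
    using sum_overlap_increment[OF assms(2), of u v g] by simp
qed

lemma rs_sum_eq_double_sum:
  assumes "p tagged_division_of {a..b}" "p' tagged_division_of {a..b}"
  shows "rs_sum f g p = (\<Sum>(\<xi>, k)\<in>p. \<Sum>(\<zeta>, l)\<in>p'. f \<xi> * overlap_increment g k l)"
  unfolding rs_sum_def
proof (rule sum.cong[OF refl], clarify)
  fix \<xi> k assume "(\<xi>, k) \<in> p"
  from increment_eq_sum_overlap[OF assms this, of g]
  show "f \<xi> * (g (Sup k) - g (Inf k)) = (\<Sum>(\<zeta>, l)\<in>p'. f \<xi> * overlap_increment g k l)"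
    by (simp add: sum_distrib_left case_prod_beta)
qed

lemma norm_overlap_increment_le:
  assumes "increments_dominated_on g V a b"
    and "p tagged_division_of {a..b}" "p' tagged_division_of {a..b}"
    and "(\<xi>, k) \<in> p" "(\<zeta>, l) \<in> p'"
  shows "norm (overlap_increment g k l) \<le> overlap_increment V k l"
proof -
  obtain u v where "k = {u..v}" "u \<le> v" "a \<le> u" "v \<le> b"
    using assms by (elim tagged_division_of_intervalE)
  moreover obtain w z where "l = {w..z}" "w \<le> z" "a \<le> w" "z \<le> b"
    using assms by (elim tagged_division_of_intervalE)
  ultimately show ?thesis
    using assms(1) by (auto simp: overlap_increment_def Let_def increments_dominated_on_def)
qed

text \<open>
  Over the common refinement both sums have the same increments of \<open>g\<close> and differ only in the tags.
  So the difference is controlled by the oscillation of \<open>f\<close> between tags of intervals that meet.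
\<close>
lemma norm_rs_sum_diff_le:
  fixes f g :: "real \<Rightarrow> 'a::real_normed_field"
  assumes dom: "increments_dominated_on g V a b" and "a \<le> b"
    and p: "p tagged_division_of {a..b}" and p': "p' tagged_division_of {a..b}"
    and osc: "\<And>\<xi> k \<zeta> l. (\<xi>, k) \<in> p \<Longrightarrow> (\<zeta>, l) \<in> p' \<Longrightarrow> k \<inter> l \<noteq> {} \<Longrightarrow> norm (f \<xi> - f \<zeta>) \<le> e"
  shows "norm (rs_sum f g p - rs_sum f g p') \<le> e * (V b - V a)"
proof -
  have "rs_sum f g p' = (\<Sum>(\<zeta>, l)\<in>p'. \<Sum>(\<xi>, k)\<in>p. f \<zeta> * overlap_increment g l k)"
    by (rule rs_sum_eq_double_sum[OF p' p])
  also have "\<dots> = (\<Sum>(\<xi>, k)\<in>p. \<Sum>(\<zeta>, l)\<in>p'. f \<zeta> * overlap_increment g k l)"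
    (* both double sums must run over the two divisions in the same order *)
    unfolding case_prod_beta by (subst sum.swap) (simp add: overlap_increment_commute)
  finally have "rs_sum f g p - rs_sum f g p' =
      (\<Sum>(\<xi>, k)\<in>p. \<Sum>(\<zeta>, l)\<in>p'. (f \<xi> - f \<zeta>) * overlap_increment g k l)"
    by (simp add: rs_sum_eq_double_sum[OF p p', of f g] case_prod_beta sum_subtractf[symmetric]
        left_diff_distrib)
  also have "norm \<dots> \<le> (\<Sum>(\<xi>, k)\<in>p. \<Sum>(\<zeta>, l)\<in>p'. e * overlap_increment V k l)"
  proof (rule sum_norm_le, clarify, rule sum_norm_le, clarify)
    fix \<xi> k \<zeta> l assume *: "(\<xi>, k) \<in> p" "(\<zeta>, l) \<in> p'"
    note le = norm_overlap_increment_le[OF dom p p' *]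
    show "norm ((f \<xi> - f \<zeta>) * overlap_increment g k l) \<le> e * overlap_increment V k l"
    proof (cases "k \<inter> l = {}")
      case True
      obtain u v w z where "k = {u..v}" "u \<le> v" "l = {w..z}" "w \<le> z"
        using * p p' by (metis tagged_division_of_intervalE)
      with True have "overlap_increment g k l = 0" "overlap_increment V k l = 0"
        by (auto simp: overlap_increment_def Let_def)
      then show ?thesis by simp
    next
      case False
      have "norm (f \<xi> - f \<zeta>) \<le> e"
        using osc[OF * False] .
      then show ?thesis
        unfolding norm_mult by (intro mult_mono le) (auto intro: order_trans[OF norm_ge_zero])
    qed
  qed
  also have "\<dots> = e * (\<Sum>(\<xi>, k)\<in>p. V (Sup k) - V (Inf k))"
    unfolding sum_distrib_left
  proof (rule sum.cong[OF refl], clarify)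
    fix \<xi> k assume "(\<xi>, k) \<in> p"
    from increment_eq_sum_overlap[OF p p' this, of V]
    show "(\<Sum>(\<zeta>, l)\<in>p'. e * overlap_increment V k l) = e * (V (Sup k) - V (Inf k))"
      by (simp add: sum_distrib_left case_prod_beta)
  qed
  also have "\<dots> = e * (V b - V a)"
    using additive_tagged_division_1[OF \<open>a \<le> b\<close> p, of V] by simp
  finally show ?thesis .
qed

lemma mesh_less_division_exists:
  assumes "\<delta> > 0"
  obtains p where "p tagged_division_of {a..b}" "mesh_less \<delta> p"
proof -
  have "gauge (\<lambda>x::real. ball x (\<delta> / 2))"
    using assms by (intro gauge_ball_dependent) auto
  then obtain p where p: "p tagged_division_of {a..b}" "(\<lambda>x. ball x (\<delta> / 2)) fine p"
    by (rule fine_division_exists_real)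
  have "mesh_less \<delta> p"
    unfolding mesh_less_def
  proof clarify
    fix \<xi> k assume "(\<xi>, k) \<in> p"
    moreover from this obtain u v where "k = {u..v}" "u \<le> v"
      using p by (elim tagged_division_of_intervalE)
    ultimately show "Sup k - Inf k < \<delta>"
      using fineD[OF p(2), of \<xi> k] by (auto simp: subset_iff dist_real_def)
       (smt (verit) atLeastAtMost_iff field_sum_of_halves)
  qed
  with p(1) show thesis by (rule that)
qed

lemma has_rs_integral_unique:
  assumes "has_rs_integral I f g a b" "has_rs_integral J f g a b"
  shows "I = J"
proof (rule ccontr)
  assume "I \<noteq> J"
  then have pos: "norm (I - J) / 2 > 0" by simp
  obtain \<delta>1 where \<delta>1: "\<delta>1 > 0" "\<And>p. p tagged_division_of {a..b} \<Longrightarrow> mesh_less \<delta>1 p \<Longrightarrow>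
      norm (rs_sum f g p - I) < norm (I - J) / 2"
    by (rule has_rs_integralE[OF assms(1) pos]) blast
  obtain \<delta>2 where \<delta>2: "\<delta>2 > 0" "\<And>p. p tagged_division_of {a..b} \<Longrightarrow> mesh_less \<delta>2 p \<Longrightarrow>
      norm (rs_sum f g p - J) < norm (I - J) / 2"
    by (rule has_rs_integralE[OF assms(2) pos]) blast
  obtain p where p: "p tagged_division_of {a..b}" "mesh_less (min \<delta>1 \<delta>2) p"
    using mesh_less_division_exists[of "min \<delta>1 \<delta>2"] \<delta>1(1) \<delta>2(1) by auto
  then have "mesh_less \<delta>1 p" "mesh_less \<delta>2 p"
    by (auto simp: mesh_less_def)
  then have "norm (rs_sum f g p - I) < norm (I - J) / 2" "norm (rs_sum f g p - J) < norm (I - J) / 2"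
    using \<delta>1(2) \<delta>2(2) p(1) by auto
  then show False
    using norm_triangle_ineq4[of "rs_sum f g p - J" "rs_sum f g p - I"] by simp
qed

lemma rs_integral_eq: "has_rs_integral I f g a b \<Longrightarrow> rs_integral f g a b = I"
  unfolding rs_integral_def by (blast intro: has_rs_integral_unique)

section \<open>Existence and estimates of Riemann--Stieltjes integrals\<close>

text \<open>
  Tags of two meeting intervals of length below \<open>\<delta>/2\<close> are less than \<open>\<delta>\<close> apart, and \<open>f\<close> is
  uniformly continuous.
\<close>
lemma rs_sum_cauchy:
  fixes f g :: "real \<Rightarrow> 'a::real_normed_field"
  assumes "a \<le> b" and f: "continuous_on {a..b} f" and dom: "increments_dominated_on g V a b"
    and "e > 0"
  obtains \<delta> where "\<delta> > 0"
    and "\<And>p p'. p tagged_division_of {a..b} \<Longrightarrow> p' tagged_division_of {a..b} \<Longrightarrow>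
          mesh_less \<delta> p \<Longrightarrow> mesh_less \<delta> p' \<Longrightarrow> norm (rs_sum f g p - rs_sum f g p') < e"
proof -
  (* the summand 1 makes the bound strict and covers the case V a = V b *)
  define e' where "e' = e / (V b - V a + 1)"
  have "norm (g b - g a) \<le> V b - V a"
    using dom \<open>a \<le> b\<close> by (simp add: increments_dominated_on_def)
  then have V: "V b - V a \<ge> 0"
    using norm_ge_zero[of "g b - g a"] by linarith
  with \<open>e > 0\<close> have "e' > 0" by (simp add: e'_def)
  have "uniformly_continuous_on {a..b} f"
    using f by (intro compact_uniformly_continuous) auto
  then obtain \<delta> where \<delta>: "\<delta> > 0"
    "\<And>x y. x \<in> {a..b} \<Longrightarrow> y \<in> {a..b} \<Longrightarrow> dist x y < \<delta> \<Longrightarrow> dist (f x) (f y) < e'"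
    using \<open>e' > 0\<close> unfolding uniformly_continuous_on_def by metis
  show thesis
  proof (rule that[of "\<delta> / 2"])
    show "\<delta> / 2 > 0" using \<delta>(1) by simp
    fix p p' assume p: "p tagged_division_of {a..b}" and p': "p' tagged_division_of {a..b}"
      and mesh: "mesh_less (\<delta> / 2) p" "mesh_less (\<delta> / 2) p'"
    have "norm (rs_sum f g p - rs_sum f g p') \<le> e' * (V b - V a)"
    proof (rule norm_rs_sum_diff_le[OF dom \<open>a \<le> b\<close> p p'])
      fix \<xi> k \<zeta> l assume *: "(\<xi>, k) \<in> p" "(\<zeta>, l) \<in> p'" "k \<inter> l \<noteq> {}"
      obtain u v where k: "k = {u..v}" "u \<le> v" "a \<le> u" "v \<le> b" "\<xi> \<in> {u..v}"
        using * p by (elim tagged_division_of_intervalE)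
      obtain w z where l: "l = {w..z}" "w \<le> z" "a \<le> w" "z \<le> b" "\<zeta> \<in> {w..z}"
        using * p' by (elim tagged_division_of_intervalE)
      obtain s where "s \<in> k" "s \<in> l"
        using *(3) by blast
      moreover have "v - u < \<delta> / 2" "z - w < \<delta> / 2"
        using mesh *(1,2) k(1,2) l(1,2) by (force simp: mesh_less_def)+
      ultimately have "dist \<xi> \<zeta> < \<delta>"
        using k l by (auto simp: dist_real_def)
      then show "norm (f \<xi> - f \<zeta>) \<le> e'"
        using \<delta>(2)[of \<xi> \<zeta>] k l by (simp add: dist_norm)
    qed
    also have "\<dots> < e"
      using V \<open>e > 0\<close> by (simp add: e'_def field_simps)
    finally show "norm (rs_sum f g p - rs_sum f g p') < e" .
  qed
qed

lemma has_rs_integral_exists: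
  fixes f g :: "real \<Rightarrow> 'a::{real_normed_field, banach}"
  assumes "a \<le> b" and f: "continuous_on {a..b} f" and dom: "increments_dominated_on g V a b"
  shows "has_rs_integral (rs_integral f g a b) f g a b"
proof -
  have "\<exists>p. p tagged_division_of {a..b} \<and> mesh_less (inverse (real (Suc n))) p" for n
    using mesh_less_division_exists[of "inverse (real (Suc n))" a b] by auto
  then obtain P where P: "\<And>n. P n tagged_division_of {a..b}"
      "\<And>n. mesh_less (inverse (real (Suc n))) (P n)"
    by metis
  have fine: "\<exists>N. \<forall>n\<ge>N. mesh_less \<delta> (P n)" if "\<delta> > 0" for \<delta>
  proof -
    obtain N where "inverse (real (Suc N)) < \<delta>"
      using reals_Archimedean[OF \<open>\<delta> > 0\<close>] by blast
    then have "\<forall>n\<ge>N. inverse (real (Suc n)) < \<delta>"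
      by (auto intro: le_less_trans[rotated] le_imp_inverse_le)
    then show ?thesis
      using P(2) unfolding mesh_less_def by (metis (no_types, lifting) case_prodE case_prodI2 less_trans old.prod.case)
  qed
  have "Cauchy (\<lambda>n. rs_sum f g (P n))"
  proof (rule metric_CauchyI)
    fix e :: real assume "e > 0"
    obtain \<delta> where "\<delta> > 0" and \<delta>: "\<And>p p'. p tagged_division_of {a..b} \<Longrightarrow> p' tagged_division_of {a..b} \<Longrightarrow>
          mesh_less \<delta> p \<Longrightarrow> mesh_less \<delta> p' \<Longrightarrow> norm (rs_sum f g p - rs_sum f g p') < e"
      by (rule rs_sum_cauchy[OF assms \<open>e > 0\<close>]) blast
    then show "\<exists>N. \<forall>m\<ge>N. \<forall>n\<ge>N. dist (rs_sum f g (P m)) (rs_sum f g (P n)) < e"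
      using fine[OF \<open>\<delta> > 0\<close>] P(1) by (metis dist_norm)
  qed
  then obtain I where I: "(\<lambda>n. rs_sum f g (P n)) \<longlonglongrightarrow> I"
    by (auto simp: Cauchy_convergent_iff convergent_def)
  have "has_rs_integral I f g a b"
    unfolding has_rs_integral_iff
  proof (intro allI impI)
    fix e :: real assume "e > 0"
    then have "e / 2 > 0" by simp
    obtain \<delta> where "\<delta> > 0" and \<delta>: "\<And>p p'. p tagged_division_of {a..b} \<Longrightarrow> p' tagged_division_of {a..b} \<Longrightarrow>
          mesh_less \<delta> p \<Longrightarrow> mesh_less \<delta> p' \<Longrightarrow> norm (rs_sum f g p - rs_sum f g p') < e / 2"
      by (rule rs_sum_cauchy[OF assms \<open>e / 2 > 0\<close>]) blast
    have "norm (rs_sum f g p - I) < e" if p: "p tagged_division_of {a..b} \<and> mesh_less \<delta> p" for p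
    proof -
      obtain N where N: "\<forall>n\<ge>N. mesh_less \<delta> (P n)"
        using fine[OF \<open>\<delta> > 0\<close>] by blast
      have "norm (rs_sum f g p - I) \<le> e / 2"
      proof (rule LIMSEQ_le_const2)
        show "(\<lambda>n. norm (rs_sum f g p - rs_sum f g (P n))) \<longlonglongrightarrow> norm (rs_sum f g p - I)"
          by (intro tendsto_intros I)
        show "\<exists>N. \<forall>n\<ge>N. norm (rs_sum f g p - rs_sum f g (P n)) \<le> e / 2"
          using N \<delta> P(1) p by (meson less_imp_le)
      qed
      with \<open>e > 0\<close> show ?thesis by simp
    qed
    with \<open>\<delta> > 0\<close> show "\<exists>\<delta>>0. \<forall>p. p tagged_division_of {a..b} \<and> mesh_less \<delta> p \<longrightarrow> norm (rs_sum f g p - I) < e"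
      by blast
  qed
  then show ?thesis
    using rs_integral_eq by metis
qed

text \<open>
  The factor \<open>c\<close> is kept outside the integral of \<open>h\<close>, so that the estimate can be applied with a bound
  on the integrand that is a multiple of a fixed function, without integrating that multiple.
\<close>
lemma norm_has_rs_integral_le:
  fixes f g :: "real \<Rightarrow> 'a::real_normed_field" and h V :: "real \<Rightarrow> real"
  assumes I: "has_rs_integral I f g a b" and J: "has_rs_integral J h V a b"
    and dom: "increments_dominated_on g V a b"
    and le: "\<And>\<theta>. \<theta> \<in> {a..b} \<Longrightarrow> norm (f \<theta>) \<le> c * h \<theta>"
  shows "norm I \<le> c * J"
proof (rule field_le_epsilon)
  fix e :: real assume "e > 0"
  (* one error e' from the sum of f and an error \<bar>c\<bar> * e' from the sum of h add up to e *)
  define e' where "e' = e / (1 + \<bar>c\<bar>)"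
  have "e' > 0" using \<open>e > 0\<close> by (simp add: e'_def)
  obtain \<delta>1 where \<delta>1: "\<delta>1 > 0" "\<And>p. p tagged_division_of {a..b} \<Longrightarrow> mesh_less \<delta>1 p \<Longrightarrow>
      norm (rs_sum f g p - I) < e'"
    by (rule has_rs_integralE[OF I \<open>e' > 0\<close>]) blast
  obtain \<delta>2 where \<delta>2: "\<delta>2 > 0" "\<And>p. p tagged_division_of {a..b} \<Longrightarrow> mesh_less \<delta>2 p \<Longrightarrow>
      norm (rs_sum h V p - J) < e'"
    by (rule has_rs_integralE[OF J \<open>e' > 0\<close>]) blast
  obtain p where p: "p tagged_division_of {a..b}" "mesh_less (min \<delta>1 \<delta>2) p"
    using mesh_less_division_exists[of "min \<delta>1 \<delta>2"] \<delta>1(1) \<delta>2(1) by auto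
  then have mesh: "mesh_less \<delta>1 p" "mesh_less \<delta>2 p"
    by (auto simp: mesh_less_def)
  have 1: "norm (rs_sum f g p - I) < e'" and 2: "\<bar>rs_sum h V p - J\<bar> < e'"
    using \<delta>1(2)[OF p(1) mesh(1)] \<delta>2(2)[OF p(1) mesh(2)] by auto
  have "norm (rs_sum f g p) \<le> (\<Sum>(\<xi>, k)\<in>p. c * (h \<xi> * (V (Sup k) - V (Inf k))))"
    unfolding rs_sum_def
  proof (rule sum_norm_le, clarify)
    fix \<xi> k assume "(\<xi>, k) \<in> p"
    then obtain u v where "k = {u..v}" "u \<le> v" "a \<le> u" "v \<le> b" "\<xi> \<in> {u..v}"
      using p(1) by (elim tagged_division_of_intervalE)
    then have "norm (g (Sup k) - g (Inf k)) \<le> V (Sup k) - V (Inf k)" "norm (f \<xi>) \<le> c * h \<xi>"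
      using dom le by (auto simp: increments_dominated_on_def)
    then have "norm (f \<xi> * (g (Sup k) - g (Inf k))) \<le> (c * h \<xi>) * (V (Sup k) - V (Inf k))"
      unfolding norm_mult by (intro mult_mono) (auto intro: order_trans[OF norm_ge_zero])
    then show "norm (f \<xi> * (g (Sup k) - g (Inf k))) \<le> c * (h \<xi> * (V (Sup k) - V (Inf k)))"
      by (simp add: mult.assoc)
  qed
  also have "\<dots> = c * rs_sum h V p"
    by (simp add: rs_sum_def sum_distrib_left case_prod_beta)
  finally have "norm I \<le> c * rs_sum h V p + e'"
    using 1 norm_triangle_ineq3[of I "rs_sum f g p"] by (simp add: norm_minus_commute)
  moreover have "c * (rs_sum h V p - J) \<le> \<bar>c\<bar> * e'"
    using 2 by (metis abs_ge_self abs_ge_zero abs_mult less_imp_le mult_left_mono order_trans)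
  moreover have "(1 + \<bar>c\<bar>) * e' = e"
    by (simp add: e'_def)
  ultimately show "norm I \<le> c * J + e"
    by (simp add: algebra_simps)
qed

lemma increments_dominated_on_self:
  assumes "increments_dominated_on g V a b"
  shows "increments_dominated_on V V a b"
  using assms unfolding increments_dominated_on_def
  by (smt (verit) norm_ge_zero real_norm_def)

text \<open>
  A division of \<open>[a,u]\<close> together with the interval \<open>[u,v]\<close> is a division of \<open>[a,v]\<close>. For the suprema to
  be meaningful the variation sums over \<open>[a,v]\<close> must be bounded, which follows from bounded variation
  on \<open>[a,b]\<close> by the same extension.
\<close>
lemma increments_dominated_by_total_variation:
  assumes bv: "bounded_variation_on g a b"
  shows "increments_dominated_on g (total_variation g a) a b"
  unfolding increments_dominated_on_def
proof (intro allI impI)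
  let ?S = "\<lambda>D. \<Sum>k\<in>D. norm (g (Sup k) - g (Inf k))"
  obtain B where B: "\<And>D. D division_of {a..b} \<Longrightarrow> ?S D \<le> B"
    using bv by (auto simp: bounded_variation_on_def)
  have extend: "insert {u..v} D division_of {a..v} \<and>
      ?S (insert {u..v} D) = ?S D + norm (g v - g u)"
    if "a \<le> u" "u < v" "D division_of {a..u}" for u v D
  proof -
    (* a member of D is contained in {a..u}; otherwise the new summand could be absorbed by insert *)
    have "{u..v} \<notin> D"
      using division_ofD(2)[OF that(3), of "{u..v}"] that(2) by auto
    moreover have "finite D" using that(3) by auto
    moreover have "{{u..v}} \<union> D division_of {u..v} \<union> {a..u}"
      using that division_of_self[of u v]
      by (intro division_disjoint_union) auto
    moreover have "{u..v} \<union> {a..u} = {a..v}" using that by auto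
    ultimately show ?thesis using that by (simp add: add.commute)
  qed
  have bdd: "bdd_above (?S ` {D. D division_of {a..v}})" if "a \<le> v" "v \<le> b" for v
  proof (rule bdd_aboveI2[where M = B], safe)
    fix D assume D: "D division_of {a..v}"
    show "?S D \<le> B"
    proof (cases "v = b")
      case False
      with that D have "insert {v..b} D division_of {a..b}" "?S (insert {v..b} D) = ?S D + norm (g b - g v)"
        using extend[of v b D] by auto
      with B[of "insert {v..b} D"] show ?thesis
        using norm_ge_zero[of "g b - g v"] by linarith
    qed (use B D in auto)
  qed
  fix u v assume uv: "a \<le> u" "u \<le> v" "v \<le> b"
  show "norm (g v - g u) \<le> total_variation g a v - total_variation g a u"
  proof (cases "u = v")
    case False
    have "total_variation g a u \<le> total_variation g a v - norm (g v - g u)"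
      unfolding total_variation_def
    proof (rule cSUP_least)
      show "{D. D division_of {a..u}} \<noteq> {}"
        using uv division_of_self[of a u] by auto
      fix D assume "D \<in> {D. D division_of {a..u}}"
      then have "insert {u..v} D division_of {a..v}" "?S (insert {u..v} D) = ?S D + norm (g v - g u)"
        using extend[of u v D] uv False by auto
      then show "?S D \<le> (SUP D\<in>{D. D division_of {a..v}}. ?S D) - norm (g v - g u)"
        using cSUP_upper[OF _ bdd[of v], of "insert {u..v} D"] uv by auto
    qed
    then show ?thesis by simp
  qed simp
qed

lemma norm_rs_integral_le:
  fixes f g :: "real \<Rightarrow> 'a::{real_normed_field, banach}" and h :: "real \<Rightarrow> real"
  assumes "a \<le> b" and bv: "bounded_variation_on g a b"
    and f: "continuous_on {a..b} f" and h: "continuous_on {a..b} h"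
    and le: "\<And>\<theta>. \<theta> \<in> {a..b} \<Longrightarrow> norm (f \<theta>) \<le> c * h \<theta>"
  shows "norm (rs_integral f g a b) \<le> c * rs_integral h (total_variation g a) a b"
proof -
  note dom = increments_dominated_by_total_variation[OF bv]
  show ?thesis
    by (rule norm_has_rs_integral_le[OF has_rs_integral_exists[OF \<open>a \<le> b\<close> f dom]
          has_rs_integral_exists[OF \<open>a \<le> b\<close> h increments_dominated_on_self[OF dom]] dom le])
qed

section \<open>Exponential decay from a delay inequality\<close>

text \<open>
  The weight \<open>exp(a (t-T))\<close> is chosen with \<open>a > 0\<close> so small that the weighted function \<open>z\<close> still satisfies
  a delay inequality with a factor \<open>q e\<^sup>a\<^sup>r < 1\<close>. Then no maximum of \<open>z\<close> over \<open>[T-r,t]\<close> beyond \<open>T\<close> can be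
  positive, so \<open>z\<close> is bounded by its maximum over the initial interval \<open>[T-r,T]\<close>.
\<close>
lemma delay_inequality_exponential_decay:
  fixes u :: "real \<Rightarrow> real"
  assumes "r > 0" "0 \<le> q" "q < 1"
    and cont: "continuous_on {T - r..} u" and nonneg: "\<And>t. t \<ge> T - r \<Longrightarrow> u t \<ge> 0"
    and contract: "\<And>t M. t \<ge> T \<Longrightarrow> (\<And>s. s \<in> {t - r..t} \<Longrightarrow> u s \<le> M) \<Longrightarrow> u t \<le> q * M"
  obtains a C where "a > 0" "\<And>t. t \<ge> T - r \<Longrightarrow> u t \<le> C * exp (- a * (t - T))"
proof -
  (* q * exp (a * r) = 2 * q / (1 + q), which is below 1 exactly because q < 1; the choice
     ln (1 / q) / r would fail for q = 0 and give no strict inequality *)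
  define a where "a = ln (2 / (1 + q)) / r"
  have "a > 0"
    using assms(1-3) by (simp add: a_def)
  have exp_ar: "exp (a * r) = 2 / (1 + q)"
    using assms(1-3) by (simp add: a_def)
  then have less1: "q * exp (a * r) < 1"
    unfolding exp_ar using assms(2,3) by (simp add: field_simps)
  define z where "z = (\<lambda>t. u t * exp (a * (t - T)))"
  have u_eq: "u t = z t * exp (- a * (t - T))" for t
    by (simp add: z_def mult_exp_exp algebra_simps)
  have z_nonneg: "z t \<ge> 0" if "t \<ge> T - r" for t
    using nonneg[OF that] by (simp add: z_def)
  have z_cont: "continuous_on {T - r..t} z" for t
    unfolding z_def by (intro continuous_intros continuous_on_subset[OF cont]) auto
  obtain s0 where s0: "s0 \<in> {T - r..T}" "\<And>s. s \<in> {T - r..T} \<Longrightarrow> z s \<le> z s0"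
    using continuous_attains_sup[OF _ _ z_cont[of T]] \<open>r > 0\<close> by auto
  have "z t \<le> z s0" if t: "t \<ge> T - r" for t
  proof -
    obtain s where s: "s \<in> {T - r..t}" and max: "\<And>\<sigma>. \<sigma> \<in> {T - r..t} \<Longrightarrow> z \<sigma> \<le> z s"
      using continuous_attains_sup[OF _ _ z_cont[of t]] t by auto
    have "z s \<le> z s0"
    proof (cases "s \<le> T")
      case True
      with s show ?thesis by (intro s0) auto
    next
      case False
      have "u \<sigma> \<le> z s * exp (- a * (s - r - T))" if "\<sigma> \<in> {s - r..s}" for \<sigma>
        unfolding u_eq[of \<sigma>] using that False s \<open>a > 0\<close>
        by (intro mult_mono max z_nonneg) auto
      then have "u s \<le> q * (z s * exp (- a * (s - r - T)))"
        using False by (intro contract) auto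
      then have "z s \<le> q * (z s * exp (- a * (s - r - T))) * exp (a * (s - T))"
        unfolding z_def by (intro mult_right_mono) auto
      also have "\<dots> = (q * exp (a * r)) * z s"
        by (simp add: mult_exp_exp algebra_simps)
      finally have "(1 - q * exp (a * r)) * z s \<le> 0"
        by (simp add: algebra_simps)
      then have "z s \<le> 0"
        using less1 by (simp add: mult_le_0_iff)
      also have "0 \<le> z s0"
        using s0 z_nonneg by auto
      finally show ?thesis .
    qed
    with max[of t] t show ?thesis by auto
  qed
  then show thesis
    using u_eq by (intro that[of a "z s0"] \<open>a > 0\<close>) (simp add: mult_right_mono)
qed

section \<open>Functions with an exponentially decaying derivative\<close>

lemma norm_diff_le_if_derivative_dominated:
  fixes y :: "real \<Rightarrow> 'a::real_normed_vector"
  assumes deriv: "\<And>t. t \<ge> T \<Longrightarrow> (y has_vector_derivative y' t) (at t within {T..})"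
    and \<phi>: "\<And>t. (\<phi> has_real_derivative \<phi>' t) (at t)"
    and "T \<le> s" "s \<le> t" and le: "\<And>\<tau>. s < \<tau> \<Longrightarrow> \<tau> < t \<Longrightarrow> norm (y' \<tau>) \<le> \<phi>' \<tau>"
  shows "norm (y t - y s) \<le> \<phi> t - \<phi> s"
proof (cases "s = t")
  case False
  show ?thesis
  proof (rule differentiable_bound_general[where f' = y' and \<phi>' = \<phi>'])
    show "s < t" using \<open>s \<le> t\<close> False by simp
    show "continuous_on {s..t} y"
      using \<open>T \<le> s\<close>
      by (intro continuous_on_vector_derivative[where f' = y']
            has_vector_derivative_within_subset[OF deriv]) auto
    show "continuous_on {s..t} \<phi>"
      using \<phi> DERIV_isCont by (blast intro: continuous_at_imp_continuous_on)
    fix \<tau> assume \<tau>: "s < \<tau>" "\<tau> < t"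
    then show "(y has_vector_derivative y' \<tau>) (at \<tau>)"
      using deriv[of \<tau>] \<open>T \<le> s\<close> at_within_interior[of \<tau> "{T..}"] by (simp add: interior_real_atLeast)
    show "(\<phi> has_vector_derivative \<phi>' \<tau>) (at \<tau>)"
      using \<phi>[of \<tau>] by (simp add: has_real_derivative_iff_has_vector_derivative)
    show "norm (y' \<tau>) \<le> \<phi>' \<tau>"
      using \<tau> by (rule le)
  qed
qed simp

text \<open>
  The primitive \<open>\<phi>\<close> of the bound is nondecreasing and tends to \<open>0\<close>, so \<open>-\<phi>(s)\<close> bounds every increment of
  \<open>y\<close> after time \<open>s\<close>; this is the Cauchy criterion at infinity.
\<close>
lemma convergent_if_derivative_decays_exponentially:
  fixes y :: "real \<Rightarrow> 'a::banach"
  assumes "a > 0"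
    and deriv: "\<And>t. t \<ge> T \<Longrightarrow> (y has_vector_derivative y' t) (at t within {T..})"
    and decay: "\<And>t. t \<ge> T \<Longrightarrow> norm (y' t) \<le> C * exp (- a * (t - T))"
  obtains l where "(y \<longlongrightarrow> l) at_top"
proof -
  have "0 \<le> C"
    using decay[of T] norm_ge_zero[of "y' T"] by (simp del: norm_ge_zero)
  define \<phi> where "\<phi> = (\<lambda>t. - (C / a) * exp (- a * (t - T)))"
  have \<phi>: "(\<phi> has_real_derivative C * exp (- a * (t - T))) (at t)" for t
    unfolding \<phi>_def using \<open>a > 0\<close> by (auto intro!: derivative_eq_intros)
  have bound: "norm (y t - y s) \<le> C / a * exp (- a * (s - T))" if "T \<le> s" "s \<le> t" for s t
  proof -
    have "norm (y t - y s) \<le> \<phi> t - \<phi> s"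
      using that decay by (intro norm_diff_le_if_derivative_dominated[OF deriv \<phi>]) auto
    also have "\<dots> \<le> C / a * exp (- a * (s - T))"
      using \<open>0 \<le> C\<close> \<open>a > 0\<close> by (simp add: \<phi>_def)
    finally show ?thesis .
  qed
  have lim0: "((\<lambda>s. C / a * exp (- a * (s - T))) \<longlongrightarrow> 0) at_top"
    using \<open>a > 0\<close> by real_asymp
  (* completeness yields a limit along a sequence; the bound carries the limit over to real times *)
  define Y where "Y = (\<lambda>n. y (T + real n))"
  have "Cauchy Y"
  proof (rule CauchyI')
    fix e :: real assume "e > 0"
    have "eventually (\<lambda>s. C / a * exp (- a * (s - T)) < e) at_top"
      using order_tendstoD(2)[OF lim0 \<open>e > 0\<close>] .
    then obtain S where S: "\<And>s. s \<ge> S \<Longrightarrow> C / a * exp (- a * (s - T)) < e"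
      unfolding eventually_at_top_linorder by blast
    have "dist (Y m) (Y n) < e" if "m \<ge> nat \<lceil>S - T\<rceil>" "n > m" for m n
    proof -
      have "norm (Y n - Y m) \<le> C / a * exp (- a * ((T + real m) - T))"
        unfolding Y_def using that by (intro bound) auto
      also have "\<dots> < e"
        using that by (intro S) linarith
      finally show ?thesis by (simp add: dist_norm norm_minus_commute)
    qed
    then show "\<exists>M. \<forall>m\<ge>M. \<forall>n>m. dist (Y m) (Y n) < e" by blast
  qed
  then obtain l where l: "Y \<longlonglongrightarrow> l"
    by (auto simp: Cauchy_convergent_iff convergent_def)
  have "norm (y s - l) \<le> C / a * exp (- a * (s - T))" if "s \<ge> T" for s
  proof (rule LIMSEQ_le_const2)
    show "(\<lambda>n. norm (y s - Y n)) \<longlonglongrightarrow> norm (y s - l)"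
      by (intro tendsto_intros l)
    show "\<exists>N. \<forall>n\<ge>N. norm (y s - Y n) \<le> C / a * exp (- a * (s - T))"
    proof (intro exI allI impI)
      fix n assume "n \<ge> nat \<lceil>s - T\<rceil>"
      then have "s \<le> T + real n" by linarith
      from bound[OF that this] show "norm (y s - Y n) \<le> C / a * exp (- a * (s - T))"
        by (simp add: Y_def norm_minus_commute)
    qed
  qed
  then have "((\<lambda>s. y s - l) \<longlongrightarrow> 0) at_top"
    by (intro Lim_null_comparison[OF _ lim0] eventually_at_top_linorderI[of T])
  then show thesis
    by (intro that) (simp add: LIM_zero_iff)
qed

section \<open>Derivatives on half-lines and the limit superior condition\<close>

lemma has_vector_derivative_integral_atLeast:
  fixes f :: "real \<Rightarrow> 'a::banach"
  assumes "continuous_on {c..} f" "t \<ge> c"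
  shows "((\<lambda>s. integral {c..s} f) has_vector_derivative f t) (at t within {c..})"
proof -
  have "((\<lambda>s. integral {c..s} f) has_vector_derivative f t) (at t within {c..t + 1})"
    using assms by (intro integral_has_vector_derivative continuous_on_subset[OF assms(1)]) auto
  moreover have "at t within {c..t + 1} = at t within {c..}"
    by (rule at_within_nhd[of _ "{..<t + 1}"]) auto
  ultimately show ?thesis by simp
qed

lemma vector_derivative_within_atLeast:
  assumes "(f has_vector_derivative f') (at t within {c..})" "t \<ge> c"
  shows "vector_derivative f (at t within {c..}) = f'"
proof (rule vector_derivative_within[OF _ assms(1)])
  have "t islimpt {c..}"
  proof (rule connected_imp_perfect)
    have "t \<in> {c..}" "t + 1 \<in> {c..}" using assms(2) by simp_all
    moreover have "t \<noteq> t + 1" by simp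
    ultimately show "{c..} \<noteq> {s}" for s by (metis singletonD)
  qed (use assms(2) in auto)
  then show "at t within {c..} \<noteq> bot"
    by (simp add: trivial_limit_within)
qed

lemma Limsup_less_one_imp_eventually_le:
  assumes "Limsup F (\<lambda>t. ereal (Q t)) < 1"
  obtains q :: real where "0 \<le> q" "q < 1" "eventually (\<lambda>t. Q t \<le> q) F"
proof -
  obtain c where c: "Limsup F (\<lambda>t. ereal (Q t)) < ereal c" "ereal c < 1"
    using ereal_dense2[OF assms] by blast
  have "eventually (\<lambda>t. Q t \<le> max c 0) F"
    using Limsup_lessD[OF c(1)] by eventually_elim simp
  moreover have "c < 1" using c(2) by simp
  ultimately show thesis by (intro that[of "max c 0"]) auto
qed

section \<open>Comparison of a solution with the exponential of a characteristic function\<close>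

locale rfde_with_characteristic_solution =
  fixes r t\<^sub>0 :: real
    and L :: "real \<Rightarrow> (real \<Rightarrow> complex) \<Rightarrow> complex"
    and \<eta> :: "real \<Rightarrow> real \<Rightarrow> complex"
    and lam x x' :: "real \<Rightarrow> complex"
  assumes r_pos: "r > 0"
    and linear: "\<And>t. t \<ge> t\<^sub>0 \<Longrightarrow> bounded_linear_functional_C r (L t)"
    and repr: "\<And>t \<phi>. t \<ge> t\<^sub>0 \<Longrightarrow> continuous_on {-r..0} \<phi> \<Longrightarrow>
           L t \<phi> = rs_integral (\<lambda>\<theta>. \<phi> (-\<theta>)) (\<eta> t) 0 r"
    and bv: "\<And>t. t \<ge> t\<^sub>0 \<Longrightarrow> bounded_variation_on (\<eta> t) 0 r"
    and lam_cont: "continuous_on {t\<^sub>0 - r..} lam"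
    and char_eq: "\<And>t. t \<ge> t\<^sub>0 \<Longrightarrow>
           lam t = rs_integral (\<lambda>\<theta>. exp (- integral {t - \<theta>..t} lam)) (\<eta> t) 0 r"
    and x_cont: "continuous_on {t\<^sub>0 - r..} x"
    and x_deriv: "\<And>t. t \<ge> t\<^sub>0 \<Longrightarrow> (x has_vector_derivative x' t) (at t within {t\<^sub>0..})"
    and x_eq: "\<And>t. t \<ge> t\<^sub>0 \<Longrightarrow> x' t = L t (segment_at x t)"
    and x'_cont: "continuous_on {t\<^sub>0..} x'"
begin

definition \<Lambda> :: "real \<Rightarrow> complex" where "\<Lambda> s = integral {t\<^sub>0..s} lam"
definition y :: "real \<Rightarrow> complex" where "y s = x s * exp (- \<Lambda> s)"
definition y' :: "real \<Rightarrow> complex" where "y' s = (x' s - lam s * x s) * exp (- \<Lambda> s)"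

lemma lam_cont': "continuous_on {t\<^sub>0..} lam"
  using r_pos by (intro continuous_on_subset[OF lam_cont]) auto

lemma \<Lambda>_deriv: "t \<ge> t\<^sub>0 \<Longrightarrow> (\<Lambda> has_vector_derivative lam t) (at t within {t\<^sub>0..})"
  unfolding \<Lambda>_def by (rule has_vector_derivative_integral_atLeast[OF lam_cont'])

lemma \<Lambda>_cont: "continuous_on {t\<^sub>0..} \<Lambda>"
  using \<Lambda>_deriv by (intro continuous_on_vector_derivative) auto

lemma y_deriv:
  assumes "t \<ge> t\<^sub>0"
  shows "(y has_vector_derivative y' t) (at t within {t\<^sub>0..})"
proof -
  have "((\<lambda>z. exp (- z)) has_field_derivative - exp (- \<Lambda> t)) (at (\<Lambda> t) within \<Lambda> ` {t\<^sub>0..})"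
    by (auto intro!: derivative_eq_intros)
  from field_vector_diff_chain_within[OF \<Lambda>_deriv[OF assms] this]
  have "((\<lambda>s. exp (- \<Lambda> s)) has_vector_derivative lam t * - exp (- \<Lambda> t)) (at t within {t\<^sub>0..})"
    by (simp add: o_def)
  from has_vector_derivative_mult[OF x_deriv[OF assms] this]
  show ?thesis
    by (simp add: y_def[abs_def] y'_def algebra_simps)
qed

lemma y'_cont: "continuous_on {t\<^sub>0..} y'"
  unfolding y'_def using r_pos
  by (intro continuous_intros x'_cont lam_cont' \<Lambda>_cont continuous_on_subset[OF x_cont]) auto

text \<open>
  The restriction to \<open>s \<ge> t\<^sub>0\<close> is essential, because \<open>\<Lambda>\<close> is \<open>0\<close> before \<open>t\<^sub>0\<close>, where its interval of integration
  is empty. It is the reason why the estimates below begin at \<open>t\<^sub>0 + r\<close>.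
\<close>
lemma integral_window:
  assumes "t\<^sub>0 \<le> s" "s \<le> t"
  shows "integral {s..t} lam = \<Lambda> t - \<Lambda> s"
proof -
  have "lam integrable_on {t\<^sub>0..t}"
    by (intro integrable_continuous_real continuous_on_subset[OF lam_cont']) auto
  from Henstock_Kurzweil_Integration.integral_combine[OF assms this] show ?thesis
    unfolding \<Lambda>_def by (simp add: algebra_simps)
qed

lemma window_weight:
  assumes "t \<ge> t\<^sub>0 + r" "\<theta> \<in> {0..r}"
  shows "exp (- integral {t - \<theta>..t} lam) = exp (\<Lambda> (t - \<theta>) - \<Lambda> t)"
  using assms integral_window[of "t - \<theta>" t] by simp

lemma window_weight_cont:
  assumes "t \<ge> t\<^sub>0 + r"
  shows "continuous_on {0..r} (\<lambda>\<theta>. exp (- integral {t - \<theta>..t} lam))"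
proof -
  have "continuous_on {0..r} (\<lambda>\<theta>. exp (\<Lambda> (t - \<theta>) - \<Lambda> t))"
    using assms by (intro continuous_intros continuous_on_compose2[OF \<Lambda>_cont]) auto
  then show ?thesis
    by (rule continuous_on_eq) (simp only: window_weight[OF assms])
qed

text \<open>
  Both \<open>x'(t)\<close> and \<open>\<lambda>(t)\<close> are values of the functional \<open>L(t)\<close>, at the segment of \<open>x\<close> and at the exponential
  weight. By linearity \<open>x'(t) - \<lambda>(t) x(t)\<close> is its value at a single function.
\<close>
lemma y'_eq_rs_integral:
  assumes t: "t \<ge> t\<^sub>0 + r"
  shows "y' t = exp (- \<Lambda> t) *
    rs_integral (\<lambda>\<theta>. x (t - \<theta>) - x t * exp (- integral {t - \<theta>..t} lam)) (\<eta> t) 0 r"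
proof -
  have t0: "t \<ge> t\<^sub>0" using t r_pos by simp
  define w where "w = (\<lambda>\<theta>. exp (- integral {t + \<theta>..t} lam))"
  have w: "continuous_on {-r..0} w"
    using continuous_on_compose2[OF window_weight_cont[OF t], of "{-r..0}" uminus]
      continuous_on_minus[OF continuous_on_id, of "{-r..0}"]
    by (simp add: w_def)
  have seg: "continuous_on {-r..0} (segment_at x t)"
    unfolding segment_at_def using t0
    by (intro continuous_on_compose2[OF x_cont] continuous_intros) auto
  have "rs_integral (\<lambda>\<theta>. x (t - \<theta>) - x t * exp (- integral {t - \<theta>..t} lam)) (\<eta> t) 0 r
      = L t (\<lambda>\<theta>. segment_at x t \<theta> + - x t * w \<theta>)"
    using repr[OF t0 continuous_on_add[OF seg continuous_on_mult_left[OF w, of "- x t"]]]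
    by (simp add: segment_at_def w_def)
  also have "\<dots> = L t (segment_at x t) + L t (\<lambda>\<theta>. - x t * w \<theta>)"
    using linear[OF t0] seg w continuous_on_mult_left[OF w, of "- x t"]
    unfolding bounded_linear_functional_C_def by blast
  also have "L t (\<lambda>\<theta>. - x t * w \<theta>) = - x t * L t w"
    using linear[OF t0] w unfolding bounded_linear_functional_C_def by blast
  also have "L t w = lam t"
    using repr[OF t0 w] char_eq[OF t0] by (simp add: w_def)
  finally show ?thesis
    using x_eq[OF t0] by (simp add: y'_def mult.commute)
qed

text \<open>
  The integrand of \<open>y'_eq_rs_integral\<close>, multiplied by \<open>exp(-\<Lambda>(t))\<close>, is the weight times
  \<open>y(t-\<theta>) - y(t)\<close>, to which the mean value inequality applies.
\<close>
lemma norm_y'_le: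
  assumes t: "t \<ge> t\<^sub>0 + r" and M: "\<And>s. s \<in> {t - r..t} \<Longrightarrow> norm (y' s) \<le> M"
  shows "norm (y' t) \<le> M * rs_integral (\<lambda>\<theta>. \<theta> * norm (exp (- integral {t - \<theta>..t} lam)))
           (\<lambda>\<theta>. total_variation (\<eta> t) 0 \<theta>) 0 r"
proof -
  let ?w = "\<lambda>\<theta>. exp (- integral {t - \<theta>..t} lam)"
  have t0: "t \<ge> t\<^sub>0" using t r_pos by simp
  have pos: "norm (exp (- \<Lambda> t)) > 0" by simp
  have bound: "norm (x (t - \<theta>) - x t * ?w \<theta>) \<le> M / norm (exp (- \<Lambda> t)) * (\<theta> * norm (?w \<theta>))"
    if \<theta>: "\<theta> \<in> {0..r}" for \<theta>
  proof -
    have "norm (y t - y (t - \<theta>)) \<le> M * t - M * (t - \<theta>)"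
    proof (rule norm_diff_le_if_derivative_dominated[OF y_deriv])
      show "((\<lambda>s. M * s) has_real_derivative M) (at s)" for s
        by (auto intro!: derivative_eq_intros)
    qed (use \<theta> t M in auto)
    then have le: "norm (y (t - \<theta>) - y t) \<le> M * \<theta>"
      by (simp add: norm_minus_commute algebra_simps)
    have "exp (- \<Lambda> (t - \<theta>)) * ?w \<theta> = exp (- \<Lambda> t)"
      unfolding window_weight[OF t \<theta>] by (simp add: mult_exp_exp)
    then have "(x (t - \<theta>) - x t * ?w \<theta>) * exp (- \<Lambda> t) = (y (t - \<theta>) - y t) * ?w \<theta>"
      by (simp add: y_def algebra_simps)
    then have "norm (x (t - \<theta>) - x t * ?w \<theta>) * norm (exp (- \<Lambda> t)) = norm (y (t - \<theta>) - y t) * norm (?w \<theta>)"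
      by (metis norm_mult)
    also have "\<dots> \<le> M * \<theta> * norm (?w \<theta>)"
      by (intro mult_right_mono le) simp
    finally show ?thesis
      using pos by (simp add: pos_le_divide_eq mult.assoc)
  qed
  have "norm (rs_integral (\<lambda>\<theta>. x (t - \<theta>) - x t * ?w \<theta>) (\<eta> t) 0 r)
      \<le> M / norm (exp (- \<Lambda> t)) * rs_integral (\<lambda>\<theta>. \<theta> * norm (?w \<theta>)) (total_variation (\<eta> t) 0) 0 r"
  proof (rule norm_rs_integral_le[OF _ bv[OF t0] _ _ bound])
    show "continuous_on {0..r} (\<lambda>\<theta>. x (t - \<theta>) - x t * ?w \<theta>)"
      using t r_pos by (intro continuous_intros window_weight_cont continuous_on_compose2[OF x_cont]) auto
    show "continuous_on {0..r} (\<lambda>\<theta>. \<theta> * norm (?w \<theta>))"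
      using t by (intro continuous_intros window_weight_cont)
  qed (use r_pos in auto)
  then have "norm (exp (- \<Lambda> t)) * norm (rs_integral (\<lambda>\<theta>. x (t - \<theta>) - x t * ?w \<theta>) (\<eta> t) 0 r)
      \<le> norm (exp (- \<Lambda> t)) * (M / norm (exp (- \<Lambda> t)) * rs_integral (\<lambda>\<theta>. \<theta> * norm (?w \<theta>)) (total_variation (\<eta> t) 0) 0 r)"
    by (intro mult_left_mono) auto
  then show ?thesis
    using pos unfolding y'_eq_rs_integral[OF t] norm_mult by simp
qed

lemma y'_decays:
  assumes "Limsup at_top (\<lambda>t. ereal (rs_integral
             (\<lambda>\<theta>. \<theta> * norm (exp (- integral {t - \<theta>..t} lam)))
             (\<lambda>\<theta>. total_variation (\<eta> t) 0 \<theta>) 0 r)) < 1"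
  obtains a C T where "a > 0" "T \<ge> t\<^sub>0" "\<And>t. t \<ge> T \<Longrightarrow> norm (y' t) \<le> C * exp (- a * (t - T))"
proof -
  obtain q where q: "0 \<le> q" "q < 1" and ev: "eventually (\<lambda>t. rs_integral
             (\<lambda>\<theta>. \<theta> * norm (exp (- integral {t - \<theta>..t} lam)))
             (\<lambda>\<theta>. total_variation (\<eta> t) 0 \<theta>) 0 r \<le> q) at_top"
    using Limsup_less_one_imp_eventually_le[OF assms] by blast
  obtain T0 where T0: "\<And>t. t \<ge> T0 \<Longrightarrow> rs_integral
             (\<lambda>\<theta>. \<theta> * norm (exp (- integral {t - \<theta>..t} lam)))
             (\<lambda>\<theta>. total_variation (\<eta> t) 0 \<theta>) 0 r \<le> q"
    using ev unfolding eventually_at_top_linorder by blast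
  (* T \<ge> t\<^sub>0 + r, so that the whole initial interval {T - r..T} lies in the half-line
     on which y' is continuous *)
  define T where "T = max T0 (t\<^sub>0 + r)"
  have contract: "norm (y' t) \<le> q * M"
    if t: "t \<ge> T" and M: "\<And>s. s \<in> {t - r..t} \<Longrightarrow> norm (y' s) \<le> M" for t M
  proof -
    have "M \<ge> 0"
      using M[of t] r_pos norm_ge_zero[of "y' t"] by (simp del: norm_ge_zero)
    then have "M * rs_integral (\<lambda>\<theta>. \<theta> * norm (exp (- integral {t - \<theta>..t} lam)))
             (\<lambda>\<theta>. total_variation (\<eta> t) 0 \<theta>) 0 r \<le> M * q"
      using t by (intro mult_left_mono T0) (auto simp: T_def)
    with norm_y'_le[of t M] t M show ?thesis
      by (simp add: T_def mult.commute)
  qed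
  have "continuous_on {T - r..} (\<lambda>t. norm (y' t))"
    by (intro continuous_intros continuous_on_subset[OF y'_cont]) (auto simp: T_def)
  then obtain a C where "a > 0" "\<And>t. t \<ge> T - r \<Longrightarrow> norm (y' t) \<le> C * exp (- a * (t - T))"
    by (rule delay_inequality_exponential_decay[OF r_pos q _ norm_ge_zero contract]) blast+
  then show thesis
    using r_pos by (intro that[of a T C]) (auto simp: T_def)
qed

end

theorem theorem2p1:
  fixes r t\<^sub>0 :: real
    and L :: "real \<Rightarrow> (real \<Rightarrow> complex) \<Rightarrow> complex"
    and \<eta> :: "real \<Rightarrow> real \<Rightarrow> complex"
    and lam :: "real \<Rightarrow> complex"
  assumes "r > 0"
    and "\<And>t. t \<ge> t\<^sub>0 \<Longrightarrow> bounded_linear_functional_C r (L t)"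
    and "\<And>t \<phi>. t \<ge> t\<^sub>0 \<Longrightarrow> continuous_on {-r..0} \<phi> \<Longrightarrow>
           L t \<phi> = rs_integral (\<lambda>\<theta>. \<phi> (-\<theta>)) (\<eta> t) 0 r"
    and "\<And>t. t \<ge> t\<^sub>0 \<Longrightarrow> bounded_variation_on (\<eta> t) 0 r"
    and "\<And>t. t \<ge> t\<^sub>0 \<Longrightarrow> \<eta> t 0 = 0"
    and "\<And>t \<theta>. t \<ge> t\<^sub>0 \<Longrightarrow> \<theta> \<in> {0<..<r} \<Longrightarrow> continuous (at_right \<theta>) (\<eta> t)"
    and "continuous_on {t\<^sub>0 - r..} lam"
    and "\<And>t. t \<ge> t\<^sub>0 \<Longrightarrow>
           lam t = rs_integral (\<lambda>\<theta>. exp (- integral {t - \<theta>..t} lam)) (\<eta> t) 0 r"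
    and "Limsup at_top (\<lambda>t. ereal (rs_integral
             (\<lambda>\<theta>. \<theta> * norm (exp (- integral {t - \<theta>..t} lam)))
             (\<lambda>\<theta>. total_variation (\<eta> t) 0 \<theta>) 0 r)) < 1"
  shows "\<forall>x. rfde_solution r t\<^sub>0 L x \<longrightarrow>
     (\<exists>l. ((\<lambda>t. x t * exp (- integral {t\<^sub>0..t} lam)) \<longlongrightarrow> l) at_top) \<and>
     (\<forall>t\<ge>t\<^sub>0. (\<lambda>s. x s * exp (- integral {t\<^sub>0..s} lam)) differentiable (at t within {t\<^sub>0..})) \<and>
     ((\<lambda>t. vector_derivative (\<lambda>s. x s * exp (- integral {t\<^sub>0..s} lam)) (at t within {t\<^sub>0..}))
        \<longlongrightarrow> 0) at_top \<and>
     (\<forall>l. ((\<lambda>t. lam t * x t * exp (- integral {t\<^sub>0..t} lam)) \<longlongrightarrow> l) at_top \<longrightarrow>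
          ((\<lambda>t. vector_derivative x (at t within {t\<^sub>0..}) * exp (- integral {t\<^sub>0..t} lam))
             \<longlongrightarrow> l) at_top)"
proof (intro allI impI)
  fix x assume "rfde_solution r t\<^sub>0 L x"
  then obtain x' where x_cont: "continuous_on {t\<^sub>0 - r..} x" and x'_cont: "continuous_on {t\<^sub>0..} x'"
    and x_deriv: "\<And>t. t \<ge> t\<^sub>0 \<Longrightarrow> (x has_vector_derivative x' t) (at t within {t\<^sub>0..})"
    and x_eq: "\<And>t. t \<ge> t\<^sub>0 \<Longrightarrow> x' t = L t (segment_at x t)"
    unfolding rfde_solution_def by blast
  interpret rfde_with_characteristic_solution r t\<^sub>0 L \<eta> lam x x'
    by (rule rfde_with_characteristic_solution.intro[OF assms(1-4,7,8) x_cont x_deriv x_eq x'_cont])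
  have y_fold: "(\<lambda>s. x s * exp (- integral {t\<^sub>0..s} lam)) = y"
    by (simp add: y_def \<Lambda>_def fun_eq_iff)
  obtain a C T where "a > 0" "T \<ge> t\<^sub>0" and decay: "\<And>t. t \<ge> T \<Longrightarrow> norm (y' t) \<le> C * exp (- a * (t - T))"
    by (rule y'_decays[OF assms(9)]) blast
  have "(y has_vector_derivative y' t) (at t within {T..})" if "t \<ge> T" for t
    using that \<open>T \<ge> t\<^sub>0\<close> by (intro has_vector_derivative_within_subset[OF y_deriv]) auto
  then obtain l where y_lim: "(y \<longlongrightarrow> l) at_top"
    by (rule convergent_if_derivative_decays_exponentially[OF \<open>a > 0\<close> _ decay]) blast+
  have y'_lim: "(y' \<longlongrightarrow> 0) at_top"
  proof (rule Lim_null_comparison)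
    show "eventually (\<lambda>t. norm (y' t) \<le> C * exp (- a * (t - T))) at_top"
      using decay by (rule eventually_at_top_linorderI)
    show "((\<lambda>t. C * exp (- a * (t - T))) \<longlongrightarrow> 0) at_top"
      using \<open>a > 0\<close> by real_asymp
  qed
  have ev: "eventually (\<lambda>t. t \<ge> t\<^sub>0) at_top"
    by (rule eventually_ge_at_top)
  have y_vd: "vector_derivative y (at t within {t\<^sub>0..}) = y' t" if "t \<ge> t\<^sub>0" for t
    using vector_derivative_within_atLeast[OF y_deriv[OF that] that] .
  have x_vd: "vector_derivative x (at t within {t\<^sub>0..}) * exp (- integral {t\<^sub>0..t} lam)
      = lam t * x t * exp (- integral {t\<^sub>0..t} lam) + y' t" if "t \<ge> t\<^sub>0" for t
    using vector_derivative_within_atLeast[OF x_deriv[OF that] that]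
    by (simp add: y'_def \<Lambda>_def algebra_simps)
  show "(\<exists>l. ((\<lambda>t. x t * exp (- integral {t\<^sub>0..t} lam)) \<longlongrightarrow> l) at_top) \<and>
     (\<forall>t\<ge>t\<^sub>0. (\<lambda>s. x s * exp (- integral {t\<^sub>0..s} lam)) differentiable (at t within {t\<^sub>0..})) \<and>
     ((\<lambda>t. vector_derivative (\<lambda>s. x s * exp (- integral {t\<^sub>0..s} lam)) (at t within {t\<^sub>0..}))
        \<longlongrightarrow> 0) at_top \<and>
     (\<forall>l. ((\<lambda>t. lam t * x t * exp (- integral {t\<^sub>0..t} lam)) \<longlongrightarrow> l) at_top \<longrightarrow>
          ((\<lambda>t. vector_derivative x (at t within {t\<^sub>0..}) * exp (- integral {t\<^sub>0..t} lam))
             \<longlongrightarrow> l) at_top)"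
    unfolding y_fold
  proof (intro conjI allI impI)
    show "\<exists>l. (y \<longlongrightarrow> l) at_top"
      using y_lim by blast
    show "y differentiable (at t within {t\<^sub>0..})" if "t \<ge> t\<^sub>0" for t
      using y_deriv[OF that] by (rule differentiableI_vector)
    show "((\<lambda>t. vector_derivative y (at t within {t\<^sub>0..})) \<longlongrightarrow> 0) at_top"
      using y'_lim by (rule Lim_transform_eventually) (rule eventually_mono[OF ev], simp add: y_vd)
    fix l assume "((\<lambda>t. lam t * x t * exp (- integral {t\<^sub>0..t} lam)) \<longlongrightarrow> l) at_top"
    from tendsto_add[OF this y'_lim]
    have "((\<lambda>t. lam t * x t * exp (- integral {t\<^sub>0..t} lam) + y' t) \<longlongrightarrow> l) at_top"
      by simp
    then show "((\<lambda>t. vector_derivative x (at t within {t\<^sub>0..}) * exp (- integral {t\<^sub>0..t} lam))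
        \<longlongrightarrow> l) at_top"
      by (rule Lim_transform_eventually) (rule eventually_mono[OF ev], simp add: x_vd)
  qed
qed

end
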